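(* Let $G$ be an interval graph with a fixed interval representation $v\mapsto I(v)=[L(v),R(v)]$. Then the left-to-right orientation $\to$ of the compatibility graph $H_G$ determined by this representation is transitive: for all vertices $e,f,g$ of $H_G$, if $e\to f$ and $f\to g$, then $eg$ is an edge of $H_G$ and it is oriented as $e\to g$.
   Context: All graphs are finite, simple and undirected. An interval representation of $G$ assigns to each vertex $v$ a closed real interval $I(v)=[L(v),R(v)]$ so that two distinct vertices are adjacent precisely when their intervals intersect; $G$ is an interval graph if it has one. The compatibility graph $H_G$ has as vertices the ordered edges $(c,\ell)$ with $c\ell\in E(G)$ (each edge gives two ordered edges). Two distinct ordered edges $(c,\ell)$ and $(d,r)$ are adjacent in $H_G$ if and only if they are compatible, i.e. either (same centre) $c=d$, $\ell\ne r$ and $\ell r\notin E(G)$; or (different centres) $c\neq d$, the four vertices $c,\ell,d,r$ are distinct, and $cd,cr,\ell d,\ell r\notin E(G)$. For a vertex $e=(c,\ell)$ of $H_G$ put $\lambda(e)=\min\{L(c),L(\ell)\}$ and $\rho(e)=\max\{R(c),R(\ell)\}$, so that $I(c)\cup I(\ell)=[\lambda(e),\rho(e)]$. Each edge of $H_G$ is given exactly one direction as follows. For adjacent $e=(c,\ell)$ and $f=(c,r)$ with the same centre: $e\to f$ if $R(\ell)<L(r)$; otherwise $R(r)<L(\ell)$ and $f\to e$. For adjacent $e=(c,\ell)$ and $f=(d,r)$ with $c\neq d$: $e\to f$ if $\rho(e)<\lambda(f)$; otherwise $\rho(f)<\lambda(e)$ and $f\to e$. *)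

theory Defs
  imports Complex_Main "Graph_Theory.Graph_Theory"
begin

text \<open>
  A finite simple undirected graph is a \<^locale>\<open>pair_graph\<close>: a finite, loop-free digraph whose
  arc relation \<^term>\<open>parcs G\<close> is symmetric. Thus \<^term>\<open>(u, v) \<in> parcs G\<close> means that
  \<^term>\<open>u\<close> and \<^term>\<open>v\<close> are adjacent, and \<^term>\<open>parcs G\<close> is exactly the set of ordered edges.
\<close>

definition interval_representation ::
    "'a pair_pre_digraph \<Rightarrow> ('a \<Rightarrow> real) \<Rightarrow> ('a \<Rightarrow> real) \<Rightarrow> bool" where
  "interval_representation G L R \<longleftrightarrow>
     (\<forall>v \<in> pverts G. L v \<le> R v) \<and>
     (\<forall>u \<in> pverts G. \<forall>v \<in> pverts G. u \<noteq> v \<longrightarrow>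
        ((u, v) \<in> parcs G \<longleftrightarrow> {L u..R u} \<inter> {L v..R v} \<noteq> {}))"

fun compatible_edges :: "'a pair_pre_digraph \<Rightarrow> 'a \<times> 'a \<Rightarrow> 'a \<times> 'a \<Rightarrow> bool" where
  "compatible_edges G (c, l) (d, r) \<longleftrightarrow>
     c = d \<and> l \<noteq> r \<and> (l, r) \<notin> parcs G \<or>
     c \<noteq> d \<and> distinct [c, l, d, r] \<and>
       (c, d) \<notin> parcs G \<and> (c, r) \<notin> parcs G \<and> (l, d) \<notin> parcs G \<and> (l, r) \<notin> parcs G"

definition compatibility_graph :: "'a pair_pre_digraph \<Rightarrow> ('a \<times> 'a) pair_pre_digraph" where
  "compatibility_graph G =
     \<lparr> pverts = parcs G,
       parcs = {(e, f). e \<in> parcs G \<and> f \<in> parcs G \<and> compatible_edges G e f} \<rparr>"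

fun left_end :: "('a \<Rightarrow> real) \<Rightarrow> 'a \<times> 'a \<Rightarrow> real" where
  "left_end L (c, l) = min (L c) (L l)"

fun right_end :: "('a \<Rightarrow> real) \<Rightarrow> 'a \<times> 'a \<Rightarrow> real" where
  "right_end R (c, l) = max (R c) (R l)"

text \<open>
  \<open>oriented G L R e f\<close> says that \<open>e\<close> and \<open>f\<close> are adjacent in the compatibility graph and that
  the edge between them is directed from \<open>e\<close> to \<open>f\<close>. The clause is symmetric in form; that the
  failure of the inequality for \<open>(e, f)\<close> amounts to the inequality for \<open>(f, e)\<close>, so that every edge
  gets exactly one direction, is \<open>oriented_exactly_one\<close> below.
\<close>

definition oriented ::
    "'a pair_pre_digraph \<Rightarrow> ('a \<Rightarrow> real) \<Rightarrow> ('a \<Rightarrow> real) \<Rightarrow> 'a \<times> 'a \<Rightarrow> 'a \<times> 'a \<Rightarrow> bool" where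
  "oriented G L R e f \<longleftrightarrow>
     (e, f) \<in> parcs (compatibility_graph G) \<and>
     (if fst e = fst f then R (snd e) < L (snd f) else right_end R e < left_end L f)"

lemma pair_graph_compatibility_graph:
  assumes "pair_graph G"
  shows "pair_graph (compatibility_graph G)"
proof -
  interpret pair_graph G by fact
  have s: "(u, v) \<in> parcs G \<Longrightarrow> (v, u) \<in> parcs G" for u v
    using pair_sym_arcs by (auto simp: symmetric_def sym_def)
  have c: "compatible_edges G e f \<Longrightarrow> compatible_edges G f e" for e f
  proof -
    assume "compatible_edges G e f"
    moreover have "(u, v) \<in> parcs G \<longleftrightarrow> (v, u) \<in> parcs G" for u v
      using s by blast
    ultimately show "compatible_edges G f e"
      by (cases e; cases f) auto
  qed
  have irr: "\<not> compatible_edges G e e" for e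
    by (cases e) auto
  have "finite (parcs (compatibility_graph G))"
    by (rule finite_subset[of _ "parcs G \<times> parcs G"])
       (auto simp: compatibility_graph_def pair_finite_arcs)
  then show ?thesis
    by unfold_locales
       (auto simp: compatibility_graph_def symmetric_def sym_def pair_finite_arcs
             simp del: compatible_edges.simps dest: c irr[THEN notE])
qed

lemma oriented_exactly_one:
  assumes "pair_graph G" and rep: "interval_representation G L R"
    and adj: "(e, f) \<in> parcs (compatibility_graph G)"
  shows "oriented G L R e f \<longleftrightarrow> \<not> oriented G L R f e"
proof -
  interpret pair_graph G by fact
  interpret H: pair_graph "compatibility_graph G"
    by (rule pair_graph_compatibility_graph) fact
  have adj': "(f, e) \<in> parcs (compatibility_graph G)"
    using adj H.pair_sym_arcs unfolding symmetric_def sym_def with_proj_simps by blast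
  obtain c l d r where ef: "e = (c, l)" "f = (d, r)" by (cases e; cases f)
  have arcs: "(c, l) \<in> parcs G" "(d, r) \<in> parcs G" and comp: "compatible_edges G (c, l) (d, r)"
    using adj by (auto simp: compatibility_graph_def ef)
  have V: "c \<in> pverts G" "l \<in> pverts G" "d \<in> pverts G" "r \<in> pverts G"
    using arcs by (auto dest: in_arcsD1 in_arcsD2)
  have ne: "L v \<le> R v" if "v \<in> pverts G" for v
    using rep that by (auto simp: interval_representation_def)
  have sep: "R u < L v \<or> R v < L u"
    if "u \<in> pverts G" "v \<in> pverts G" "u \<noteq> v" "(u, v) \<notin> parcs G" for u v
    using rep that ne[of u] ne[of v] unfolding interval_representation_def
    by (metis Int_iff atLeastAtMost_iff empty_iff linorder_not_less nle_le)
  have meet: "L u \<le> R v \<and> L v \<le> R u" if "(u, v) \<in> parcs G" for u v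
  proof -
    have "u \<in> pverts G" "v \<in> pverts G" "u \<noteq> v"
      using that pair_no_loops[OF that] by (auto dest: in_arcsD1 in_arcsD2)
    then have "{L u..R u} \<inter> {L v..R v} \<noteq> {}"
      using rep that by (auto simp: interval_representation_def)
    then show ?thesis by auto
  qed
  show ?thesis
  proof (cases "c = d")
    case True
    then have "l \<noteq> r" "(l, r) \<notin> parcs G" using comp by auto
    with sep[of l r] V ne[of l] ne[of r] show ?thesis
      using True adj adj' by (auto simp: oriented_def ef)
  next
    case False
    then have "distinct [c, l, d, r]" "(c, d) \<notin> parcs G" "(c, r) \<notin> parcs G"
        "(l, d) \<notin> parcs G" "(l, r) \<notin> parcs G"
      using comp by auto
    then have "R c < L d \<or> R d < L c" "R c < L r \<or> R r < L c"
        "R l < L d \<or> R d < L l" "R l < L r \<or> R r < L l"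
      using sep V by auto
    then have "right_end R e < left_end L f \<longleftrightarrow> \<not> right_end R f < left_end L e"
      using meet[OF arcs(1)] meet[OF arcs(2)] ne[OF V(1)] ne[OF V(2)] ne[OF V(3)] ne[OF V(4)]
      unfolding ef by (simp add: max_def min_def) argo
    then show ?thesis
      using False adj adj' by (auto simp: oriented_def ef)
  qed
qed

end

theory Submission
  imports Defs
begin

text \<open>
  Compatibility of two ordered edges is forced by the inequality that defines the direction, because
  intervals that lie strictly one after the other are disjoint. So the orientation is described by
  these inequalities alone, and they chain through the middle edge. In the case of two different
  centres on either side of \<open>f\<close>, the outer centres cannot coincide, since one lies strictly
  to the left of \<open>f\<close> and the other strictly to its right.
\<close>

lemma oriented_iff:
  assumes "pair_graph G" and rep: "interval_representation G L R"
  shows "oriented G L R (c, l) (d, r) \<longleftrightarrow>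
    (c, l) \<in> parcs G \<and> (d, r) \<in> parcs G \<and>
    (if c = d then R l < L r else max (R c) (R l) < min (L d) (L r))"
proof -
  interpret pair_graph G by fact
  have sep: "u \<noteq> v \<and> (u, v) \<notin> parcs G"
    if "u \<in> pverts G" "v \<in> pverts G" "R u < L v" for u v
  proof -
    have "{L u..R u} \<inter> {L v..R v} = {}"
      using \<open>R u < L v\<close> by auto
    \<comment> \<open>For \<open>u = v\<close> the inequality would make the interval of
      \<open>u\<close> empty.\<close>
    moreover have "u \<noteq> v"
      using rep that unfolding interval_representation_def by (meson linorder_not_less)
    ultimately show ?thesis
      using rep that unfolding interval_representation_def by meson
  qed
  have loop: "u \<noteq> v" if "(u, v) \<in> parcs G" for u v
    using pair_no_loops[OF that] by simp
  have "compatible_edges G (c, l) (d, r)"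
    if arcs: "(c, l) \<in> parcs G" "(d, r) \<in> parcs G"
      and lt: "if c = d then R l < L r else max (R c) (R l) < min (L d) (L r)"
  proof -
    have V: "c \<in> pverts G" "l \<in> pverts G" "d \<in> pverts G" "r \<in> pverts G"
      using arcs by (auto dest: in_arcsD1 in_arcsD2)
    \<comment> \<open>With equal centres, the separation of \<open>l\<close> from \<open>r\<close>
      suffices. Otherwise the four cross pairs are separated, and looplessness supplies the other
      inequalities in \<open>distinct [c, l, d, r]\<close>.\<close>
    show ?thesis
      using lt sep[OF V(1,3)] sep[OF V(1,4)] sep[OF V(2,3)] sep[OF V(2,4)]
        loop[OF arcs(1)] loop[OF arcs(2)]
      by (cases "c = d") auto
  qed
  then show ?thesis
    by (auto simp: oriented_def compatibility_graph_def simp del: compatible_edges.simps)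
qed

lemma oriented_trans:
  assumes G: "pair_graph G" and rep: "interval_representation G L R"
    and ef: "oriented G L R e f" and fg: "oriented G L R f g"
  shows "oriented G L R e g"
proof -
  interpret pair_graph G by fact
  obtain c l d m b r where eqs: "e = (c, l)" "f = (d, m)" "g = (b, r)"
    by (cases e, cases f, cases g) blast
  note iff = oriented_iff[OF G rep]
  have arcs: "(c, l) \<in> parcs G" "(d, m) \<in> parcs G" "(b, r) \<in> parcs G"
    using ef fg by (auto simp: eqs iff)
  \<comment> \<open>The intervals of \<open>d\<close> and \<open>m\<close> bridge the two
    inequalities; that of \<open>c\<close> refutes \<open>c = b\<close> when \<open>d\<close>
    differs from both.\<close>
  then have "L c \<le> R c" "L d \<le> R d" "L m \<le> R m"
    using rep by (auto simp: interval_representation_def dest: in_arcsD1 in_arcsD2)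
  \<comment> \<open>If exactly one pair shares its centre, the outer centres differ: the bound at
    the shared centre is inherited from the other pair, and the bound at the outer leaf chains
    through \<open>m\<close>.\<close>
  then show ?thesis
    using ef fg arcs unfolding eqs iff by (cases "c = d"; cases "d = b"; cases "c = b") simp_all
qed

theorem lemma7:
  fixes G :: "'a pair_pre_digraph" and L R :: "'a \<Rightarrow> real"
  assumes "pair_graph G"
    and "interval_representation G L R"
  shows "\<forall>e \<in> pverts (compatibility_graph G). \<forall>f \<in> pverts (compatibility_graph G).
           \<forall>g \<in> pverts (compatibility_graph G).
             oriented G L R e f \<and> oriented G L R f g \<longrightarrow>
             (e, g) \<in> parcs (compatibility_graph G) \<and> oriented G L R e g"
proof (intro ballI impI, elim conjE)
  fix e f g
  assume "oriented G L R e f" "oriented G L R f g"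
  then have "oriented G L R e g"
    by (rule oriented_trans[OF assms])
  then show "(e, g) \<in> parcs (compatibility_graph G) \<and> oriented G L R e g"
    unfolding oriented_def by blast
qed

end
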